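(* Let $\mathcal{S}$ be a finite collection of finite sets. $\mathrm{CDC}(\mathcal{S})$ admits a junction tree if and only if each maximum spanning tree $\mathcal{T}$ of the intersection graph $\mathcal{K}_{\mathcal{S}}$ satisfies the following: for each edge $e\in E(\mathcal{T})$, with $\mathcal{S}_1$ and $\mathcal{S}_2$ the vertex sets of the two connected components of $\mathcal{T}\setminus e$, one has $$\left(\bigcup_{S\in\mathcal{S}_1}S\right)\cap\left(\bigcup_{S\in\mathcal{S}_2}S\right)\subseteq\mathrm{mid}(e).$$
   Context: Let $\mathcal{S}=\{S^i\}_{i=1}^d$ be a finite collection of finite sets, $J:=\bigcup_{S\in\mathcal{S}}S$, $Q(S):=\{\lambda\in\mathbb{R}^J:\sum_{v\in J}\lambda_v=1,\ \lambda_{J\setminus S}=0,\ \lambda\ge 0\}$ and $\mathrm{CDC}(\mathcal{S}):=\bigcup_{S\in\mathcal{S}}Q(S)$ (the combinatorial disjunctive constraint). The (complete) intersection graph $\mathcal{K}_{\mathcal{S}}$ is the complete graph with vertex set $\mathcal{S}$. The edge $S^1S^2$ has middle set $\mathrm{mid}(S^1S^2):=S^1\cap S^2$ and weight $w(S^1S^2):=|\mathrm{mid}(S^1S^2)|$. Maximum spanning trees are with respect to the total weight. A junction tree of $\mathrm{CDC}(\mathcal{S})$ is a tree with vertex set $\mathcal{S}$ such that for any $S^1,S^2\in\mathcal{S}$ the unique path $\mathcal{P}$ between them in the tree satisfies $S^1\cap S^2\subseteq S$ for every vertex $S$ of $\mathcal{P}$ and $S^1\cap S^2\subseteq\mathrm{mid}(e)$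 for every edge $e$ of $\mathcal{P}$. $\mathrm{CDC}(\mathcal{S})$ admits a junction tree if such a tree exists. *)

theory Defs
  imports Main
begin

text \<open>
  Finite simple undirected graphs; an edge is the two-element set of its endpoints.
  The predicate \<open>tree\<close> of the AFP entry Graph_Theory is not usable here: it forbids directed
  cycles, so a symmetric digraph with an edge is never a tree, whereas an acyclically oriented
  triangle is one.
\<close>

datatype 'v ugraph = UGraph (uverts: "'v set") (uedges: "'v set set")

definition all_uedges :: "'v set \<Rightarrow> 'v set set" where
  "all_uedges V = {{u, v} | u v. u \<in> V \<and> v \<in> V \<and> u \<noteq> v}"

definition simple_ugraph :: "'v ugraph \<Rightarrow> bool" where
  "simple_ugraph G \<longleftrightarrow> finite (uverts G) \<and> uedges G \<subseteq> all_uedges (uverts G)"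

definition complete_ugraph :: "'v set \<Rightarrow> 'v ugraph" where
  "complete_ugraph V = UGraph V (all_uedges V)"

definition vlist_edges :: "'v list \<Rightarrow> 'v set set" where
  "vlist_edges p = {{p ! i, p ! Suc i} | i. Suc i < length p}"

definition upath :: "'v ugraph \<Rightarrow> 'v \<Rightarrow> 'v list \<Rightarrow> 'v \<Rightarrow> bool" where
  "upath G u p v \<longleftrightarrow> p \<noteq> [] \<and> hd p = u \<and> last p = v \<and> distinct p \<and>
     set p \<subseteq> uverts G \<and> vlist_edges p \<subseteq> uedges G"

definition ucycle :: "'v ugraph \<Rightarrow> 'v list \<Rightarrow> bool" where
  "ucycle G p \<longleftrightarrow> length p \<ge> 3 \<and> distinct p \<and> set p \<subseteq> uverts G \<and>
     vlist_edges p \<subseteq> uedges G \<and> {last p, hd p} \<in> uedges G"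

definition uconnected :: "'v ugraph \<Rightarrow> bool" where
  "uconnected G \<longleftrightarrow> (\<forall>u \<in> uverts G. \<forall>v \<in> uverts G. \<exists>p. upath G u p v)"

text \<open>
  The graph without vertices counts as a tree. This matters only for the empty collection of
  sets, which therefore need not be excluded.
\<close>

definition utree :: "'v ugraph \<Rightarrow> bool" where
  "utree G \<longleftrightarrow> simple_ugraph G \<and> uconnected G \<and> (\<nexists>p. ucycle G p)"

definition uspanning_tree :: "'v ugraph \<Rightarrow> 'v ugraph \<Rightarrow> bool" where
  "uspanning_tree T G \<longleftrightarrow> utree T \<and> uverts T = uverts G \<and> uedges T \<subseteq> uedges G"

definition total_weight :: "('v set \<Rightarrow> nat) \<Rightarrow> 'v ugraph \<Rightarrow> nat" where
  "total_weight w G = (\<Sum>e \<in> uedges G. w e)"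

definition max_spanning_tree :: "('v set \<Rightarrow> nat) \<Rightarrow> 'v ugraph \<Rightarrow> 'v ugraph \<Rightarrow> bool" where
  "max_spanning_tree w T G \<longleftrightarrow> uspanning_tree T G \<and>
     (\<forall>T'. uspanning_tree T' G \<longrightarrow> total_weight w T' \<le> total_weight w T)"

definition del_uedge :: "'v ugraph \<Rightarrow> 'v set \<Rightarrow> 'v ugraph" where
  "del_uedge G e = UGraph (uverts G) (uedges G - {e})"

text \<open>Connected components are represented by their vertex sets.\<close>

definition ucomponents :: "'v ugraph \<Rightarrow> 'v set set" where
  "ucomponents G = {{v \<in> uverts G. \<exists>p. upath G u p v} | u. u \<in> uverts G}"

abbreviation intersection_graph :: "'a set set \<Rightarrow> 'a set ugraph" where
  "intersection_graph \<S> \<equiv> complete_ugraph \<S>"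

definition mid :: "'a set set \<Rightarrow> 'a set" where
  "mid e = \<Inter> e"

lemma mid_edge: "mid {S, T} = S \<inter> T"
  by (simp add: mid_def)

definition mid_weight :: "'a set set \<Rightarrow> nat" where
  "mid_weight e = card (mid e)"

text \<open>
  Junction trees of the constraint \<open>CDC(\<S>)\<close>, the union over \<open>S \<in> \<S>\<close> of the faces \<open>Q(S)\<close> of the
  standard simplex on \<open>\<Union>\<S>\<close>. They are a notion about the collection \<open>\<S>\<close> and not about that
  union as a point set: the latter does not change when subsets of members are added to \<open>\<S>\<close>.
  In a tree the path \<open>p\<close> below is the unique one between its endpoints.
\<close>

definition junction_tree :: "'a set set \<Rightarrow> 'a set ugraph \<Rightarrow> bool" where
  "junction_tree \<S> T \<longleftrightarrow> utree T \<and> uverts T = \<S> \<and>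
     (\<forall>S\<^sub>1 \<in> \<S>. \<forall>S\<^sub>2 \<in> \<S>. \<forall>p. upath T S\<^sub>1 p S\<^sub>2 \<longrightarrow>
        (\<forall>S \<in> set p. S\<^sub>1 \<inter> S\<^sub>2 \<subseteq> S) \<and> (\<forall>e \<in> vlist_edges p. S\<^sub>1 \<inter> S\<^sub>2 \<subseteq> mid e))"

definition CDC_admits_junction_tree :: "'a set set \<Rightarrow> bool" where
  "CDC_admits_junction_tree \<S> \<longleftrightarrow> (\<exists>T. junction_tree \<S> T)"

end

theory Submission
  imports Defs
begin

text \<open>
  For \<open>x \<in> \<Union>\<S>\<close> let \<open>\<S>\<^sub>x\<close> be the members of \<open>\<S>\<close> containing \<open>x\<close>. Double counting gives
  \<open>w(T) = (\<Sum>x. |E(T[\<S>\<^sub>x])|)\<close>, and the forest \<open>T[\<S>\<^sub>x]\<close> has at most \<open>|\<S>\<^sub>x| - 1\<close> edges, with equality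
  iff it is connected. A junction tree attains equality for every \<open>x\<close>; hence so does every
  maximum spanning tree once a junction tree exists. If \<open>x\<close> occurs on both sides of an edge \<open>e\<close> of
  such a tree \<open>T\<close>, then connectedness of \<open>T[\<S>\<^sub>x]\<close> forces \<open>e\<close> to be an edge of \<open>T[\<S>\<^sub>x]\<close>, that is,
  \<open>x \<in> mid e\<close>. Conversely, an edge on the path between \<open>S\<^sub>1\<close> and \<open>S\<^sub>2\<close> separates them, so any maximum
  spanning tree with the cut property is a junction tree.
\<close>

section \<open>Reachability\<close>

text \<open>Reachability depends on the edge set alone, so that subsets of one edge set can be
  compared by monotonicity. Every element of the type reaches itself, whether it is a vertex or not;
  the image of \<open>{u}\<close> is the component of \<open>u\<close>.\<close>

definition ureach :: "'v set set \<Rightarrow> ('v \<times> 'v) set" where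
  "ureach E = {(u, v). {u, v} \<in> E}\<^sup>*"

text \<open>Acyclicity in the form "every edge is a bridge", which passes to subsets and suits
  induction on edges. Loops are excluded, since \<open>u\<close> always reaches itself.\<close>

definition uforest :: "'v set set \<Rightarrow> bool" where
  "uforest E \<longleftrightarrow> (\<forall>u v. {u, v} \<in> E \<longrightarrow> (u, v) \<notin> ureach (E - {{u, v}}))"

lemma ureach_refl [simp]: "(u, u) \<in> ureach E"
  by (simp add: ureach_def)

lemma ureach_edge: "{u, v} \<in> E \<Longrightarrow> (u, v) \<in> ureach E"
  by (auto simp: ureach_def)

lemma ureach_trans: "(u, v) \<in> ureach E \<Longrightarrow> (v, w) \<in> ureach E \<Longrightarrow> (u, w) \<in> ureach E"
  unfolding ureach_def by (rule rtrancl_trans)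

lemma ureach_sym: "(u, v) \<in> ureach E \<Longrightarrow> (v, u) \<in> ureach E"
proof -
  have "sym {(u, v). {u, v} \<in> E}"
    by (auto simp: sym_def insert_commute)
  then show "(u, v) \<in> ureach E \<Longrightarrow> (v, u) \<in> ureach E"
    unfolding ureach_def by (meson sym_rtrancl symD)
qed

lemma ureach_mono: "E \<subseteq> F \<Longrightarrow> (u, v) \<in> ureach E \<Longrightarrow> (u, v) \<in> ureach F"
  unfolding ureach_def by (erule rtrancl_mono[THEN subsetD, rotated]) auto

lemma ureach_class_eq:
  assumes "(u, v) \<in> ureach E"
  shows "ureach E `` {u} = ureach E `` {v}"
  using ureach_trans[OF assms] ureach_trans[OF ureach_sym[OF assms]] by blast

lemma ureach_empty [simp]: "ureach {} = Id"
  by (simp add: ureach_def)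

lemma ureach_in_verts:
  assumes "(u, v) \<in> ureach E" "E \<subseteq> all_uedges V" "u \<in> V"
  shows "v \<in> V"
  using assms(1) unfolding ureach_def
proof (induction rule: rtrancl_induct)
  case (step y z)
  then have "{y, z} \<in> all_uedges V"
    using assms(2) by auto
  then show ?case
    by (auto simp: all_uedges_def doubleton_eq_iff)
qed (use assms(3) in simp)

text \<open>A walk can cross the new edge only if it starts in the class of \<open>a\<close> or of
  \<open>b\<close>, and it then ends in one of these two classes. So they merge, and every other
  class survives.\<close>

lemma ureach_insert:
  "ureach (insert {a, b} E) `` {w} =
    (if w \<in> ureach E `` {a, b} then ureach E `` {a, b} else ureach E `` {w})"
    (is "?L = ?R")
proof
  show "?L \<subseteq> ?R"
  proof
    fix z assume "z \<in> ?L"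
    then have "(w, z) \<in> {(u, v). {u, v} \<in> insert {a, b} E}\<^sup>*"
      by (simp add: ureach_def)
    then show "z \<in> ?R"
    proof (induction rule: rtrancl_induct)
      case base
      then show ?case by auto
    next
      case (step y z)
      consider "(y, z) \<in> ureach E" | "{y, z} = {a, b}"
        using step.hyps(2) by (auto intro: ureach_edge)
      then show ?case
      proof cases
        case 1
        with step.IH have "y \<in> ureach E `` {a, b} \<Longrightarrow> z \<in> ureach E `` {a, b}"
          "(w, y) \<in> ureach E \<Longrightarrow> (w, z) \<in> ureach E"
          using ureach_trans[OF _ 1] by auto
        then show ?thesis
          using step.IH by (simp split: if_splits)
      next
        case 2
        then have yz: "y \<in> {a, b}" "z \<in> {a, b}"
          by auto
        have "w \<in> ureach E `` {a, b}"
        proof (rule ccontr)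
          assume n: "w \<notin> ureach E `` {a, b}"
          then have "(w, y) \<in> ureach E"
            using step.IH by (auto split: if_splits)
          then show False
            using n yz(1) ureach_sym[of w y E] by auto
        qed
        moreover have "z \<in> ureach E `` {a, b}"
          using yz(2) ureach_refl[of z E] by blast
        ultimately show ?thesis
          by simp
      qed
    qed
  qed
  let ?F = "insert {a, b} E"
  have m: "(u, v) \<in> ureach ?F" if "(u, v) \<in> ureach E" for u v
    using ureach_mono[OF _ that] by blast
  have ab: "(a, b) \<in> ureach ?F"
    by (rule ureach_edge) simp
  have a: "(a, z) \<in> ureach ?F" if "z \<in> ureach E `` {a, b}" for z
    using that m[of a z] ureach_trans[OF ab m[of b z]] by auto
  show "?R \<subseteq> ?L"
  proof
    fix z assume z: "z \<in> ?R"
    show "z \<in> ?L"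
    proof (cases "w \<in> ureach E `` {a, b}")
      case True
      then have "(a, w) \<in> ureach ?F" "(a, z) \<in> ureach ?F"
        using z a by simp_all
      then show ?thesis
        using ureach_trans[OF ureach_sym[of a w]] by simp
    next
      case False
      then show ?thesis
        using z m[of w z] by simp
    qed
  qed
qed

section \<open>Counting edges of forests\<close>

lemma uforest_subset: "uforest F \<Longrightarrow> E \<subseteq> F \<Longrightarrow> uforest E"
  unfolding uforest_def by (meson Diff_mono order_refl subsetD ureach_mono)

text \<open>Rank formula: starting from \<open>card V\<close> singleton classes, each inserted
  forest edge joins two distinct classes and so lowers their number by one.\<close>

lemma uforest_card:
  assumes "finite E" "finite V" "E \<subseteq> all_uedges V" "uforest E"
  shows "card E + card ((\<lambda>w. ureach E `` {w}) ` V) = card V"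
  using assms(1,3,4)
proof (induction rule: finite_induct)
  case empty
  have "inj_on (\<lambda>w. ureach {} `` {w}) V"
    by (auto simp: inj_on_def)
  then show ?case
    using card_image[of "\<lambda>w. ureach {} `` {w}" V] by simp
next
  case (insert e E)
  then obtain a b where e: "e = {a, b}" "a \<in> V" "b \<in> V"
    by (auto simp: all_uedges_def)
  have IH: "card E + card ((\<lambda>w. ureach E `` {w}) ` V) = card V"
    using insert.IH insert.prems uforest_subset[of "insert e E" E] by auto
  let ?A = "ureach E `` {a}" and ?B = "ureach E `` {b}"
  let ?C = "(\<lambda>w. ureach E `` {w}) ` V"
  \<comment> \<open>For the newly inserted edge, the bridge condition says that its endpoints were
    in different classes before.\<close>
  have "insert e E - {e} = E"
    using insert.hyps by auto
  then have nab: "(a, b) \<notin> ureach E"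
    using insert.prems(2) e(1) by (auto simp: uforest_def)
  then have AB: "?A \<noteq> ?B"
    using ureach_refl[of b E] by blast
  have AuB: "ureach E `` {a, b} = ?A \<union> ?B"
    by auto
  have "(\<lambda>w. ureach (insert e E) `` {w}) ` V = insert (?A \<union> ?B) (?C - {?A, ?B})"
  proof (intro equalityI subsetI)
    fix X assume "X \<in> (\<lambda>w. ureach (insert e E) `` {w}) ` V"
    then obtain w where w: "w \<in> V" "X = ureach (insert e E) `` {w}"
      by blast
    show "X \<in> insert (?A \<union> ?B) (?C - {?A, ?B})"
    proof (cases "w \<in> ?A \<union> ?B")
      case True
      then show ?thesis
        using w by (simp add: e(1) ureach_insert AuB)
    next
      case False
      then have "ureach E `` {w} \<noteq> ?A" "ureach E `` {w} \<noteq> ?B"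
        using ureach_refl[of w E] by blast+
      then show ?thesis
        using w False by (simp add: e(1) ureach_insert AuB)
    qed
  next
    fix X assume X: "X \<in> insert (?A \<union> ?B) (?C - {?A, ?B})"
    show "X \<in> (\<lambda>w. ureach (insert e E) `` {w}) ` V"
    proof (cases "X = ?A \<union> ?B")
      case True
      then have "X = ureach (insert e E) `` {a}"
        by (simp add: e(1) ureach_insert AuB)
      then show ?thesis
        using e(2) by blast
    next
      case False
      then obtain w where w: "w \<in> V" "X = ureach E `` {w}" "X \<noteq> ?A" "X \<noteq> ?B"
        using X by blast
      then have "w \<notin> ?A \<union> ?B"
        using ureach_class_eq[of a w E] ureach_class_eq[of b w E] by auto
      then have "X = ureach (insert e E) `` {w}"
        using w by (simp add: e(1) ureach_insert AuB)
      then show ?thesis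
        using w(1) by blast
    qed
  qed
  \<comment> \<open>The merged class must be new; then two classes disappear, one appears, and the
    count drops by exactly one.\<close>
  moreover have "?A \<union> ?B \<notin> ?C"
  proof
    assume "?A \<union> ?B \<in> ?C"
    then obtain w where "?A \<union> ?B = ureach E `` {w}"
      by blast
    then have "(w, a) \<in> ureach E" "(w, b) \<in> ureach E"
      using ureach_refl[of a E] ureach_refl[of b E] by blast+
    then show False
      using nab ureach_trans[OF ureach_sym[of w a]] by blast
  qed
  moreover have fin: "finite ?C"
    using assms(2) by simp
  ultimately have "card ((\<lambda>w. ureach (insert e E) `` {w}) ` V) = Suc (card (?C - {?A, ?B}))"
    by simp
  moreover have "{?A, ?B} \<subseteq> ?C"
    using e by auto
  then have "card (?C - {?A, ?B}) = card ?C - 2" "2 \<le> card ?C"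
    using AB card_Diff_subset[of "{?A, ?B}" ?C] card_mono[OF fin, of "{?A, ?B}"] by auto
  ultimately show ?case
    using IH insert.hyps by simp
qed

lemma uforest_card_less:
  assumes "finite E" "finite V" "E \<subseteq> all_uedges V" "uforest E" "V \<noteq> {}"
  shows "card E < card V"
proof -
  have "card ((\<lambda>w. ureach E `` {w}) ` V) > 0"
    using assms by (simp add: card_gt_0_iff)
  then show ?thesis
    using uforest_card[OF assms(1-4)] by simp
qed

text \<open>By the rank formula the left side says that there is a single class. This is the bridge
  between edge counts, and hence weights, and connectedness.\<close>

lemma uforest_Suc_card_iff:
  assumes "finite E" "finite V" "E \<subseteq> all_uedges V" "uforest E" "V \<noteq> {}"
  shows "Suc (card E) = card V \<longleftrightarrow> V \<times> V \<subseteq> ureach E"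
proof -
  let ?C = "(\<lambda>w. ureach E `` {w}) ` V"
  have "Suc (card E) = card V \<longleftrightarrow> card ?C = 1"
    using uforest_card[OF assms(1-4)] by presburger
  also have "\<dots> \<longleftrightarrow> V \<times> V \<subseteq> ureach E"
  proof
    assume "card ?C = 1"
    then obtain X where X: "?C = {X}"
      by (rule card_1_singletonE)
    have cls: "ureach E `` {w} = X" if "w \<in> V" for w
      using imageI[OF that, of "\<lambda>w. ureach E `` {w}"] unfolding X by (rule singletonD)
    have "(u, v) \<in> ureach E" if "u \<in> V" "v \<in> V" for u v
      using cls[OF that(1)] cls[OF that(2)] ureach_refl[of v E] by blast
    then show "V \<times> V \<subseteq> ureach E"
      by auto
  next
    assume V: "V \<times> V \<subseteq> ureach E"
    obtain u where u: "u \<in> V"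
      using assms(5) by blast
    have "ureach E `` {w} = ureach E `` {u}" if "w \<in> V" for w
      using V u that by (intro ureach_class_eq) auto
    then have "?C = (\<lambda>w. ureach E `` {u}) ` V"
      by (rule image_cong[OF refl])
    then show "card ?C = 1"
      using assms(5) by (simp add: image_constant_conv)
  qed
  finally show ?thesis .
qed

section \<open>Paths\<close>

lemma vlist_edges_Cons2:
  "vlist_edges (x # y # p) = insert {x, y} (vlist_edges (y # p))"
proof (intro equalityI subsetI)
  fix e assume "e \<in> vlist_edges (x # y # p)"
  then obtain i where i: "e = {(x # y # p) ! i, (x # y # p) ! Suc i}" "Suc i < length (x # y # p)"
    by (auto simp: vlist_edges_def)
  then show "e \<in> insert {x, y} (vlist_edges (y # p))"
    by (cases i) (auto simp: vlist_edges_def)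
next
  fix e assume "e \<in> insert {x, y} (vlist_edges (y # p))"
  then consider "e = {x, y}" | i where "e = {(y # p) ! i, (y # p) ! Suc i}" "Suc i < length (y # p)"
    by (auto simp: vlist_edges_def)
  then show "e \<in> vlist_edges (x # y # p)"
  proof cases
    case 1
    then show ?thesis
      unfolding vlist_edges_def by (auto intro!: exI[of _ 0])
  next
    case 2
    then show ?thesis
      unfolding vlist_edges_def by (auto intro!: exI[of _ "Suc i"])
  qed
qed

lemma vlist_edges_short [simp]: "vlist_edges [] = {}" "vlist_edges [x] = {}"
  by (simp_all add: vlist_edges_def)

lemma vlist_edges_subset: "e \<in> vlist_edges p \<Longrightarrow> e \<subseteq> set p"
  by (auto simp: vlist_edges_def)

lemma vlist_edges_suffix: "vlist_edges q \<subseteq> vlist_edges (p @ q)"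
proof (induction p)
  case (Cons x p)
  then show ?case
    by (cases "p @ q") (auto simp: vlist_edges_Cons2)
qed simp

lemma in_vlist_edge: "v \<in> set p \<Longrightarrow> length p \<ge> 2 \<Longrightarrow> \<exists>e \<in> vlist_edges p. v \<in> e"
proof (induction p rule: induct_list012)
  case (3 x y p)
  then show ?case
    by (cases p) (auto simp: vlist_edges_Cons2)
qed auto

lemma vlist_edges_ureach: "p \<noteq> [] \<Longrightarrow> (hd p, last p) \<in> ureach (vlist_edges p)"
proof (induction p rule: induct_list012)
  case (3 x y p)
  have "(x, y) \<in> ureach (vlist_edges (x # y # p))"
    by (rule ureach_edge) (simp add: vlist_edges_Cons2)
  moreover have "(y, last (y # p)) \<in> ureach (vlist_edges (x # y # p))"
    using 3(2) ureach_mono[of "vlist_edges (y # p)" "vlist_edges (x # y # p)" y "last (y # p)"]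
    by (simp add: vlist_edges_Cons2 subset_insertI)
  ultimately show ?case
    using ureach_trans[of x y "vlist_edges (x # y # p)" "last (y # p)"] by simp
qed auto

text \<open>A walk is made simple from its end backwards: if the vertex to be prepended already lies
  on the path, the suffix starting at it is taken instead.\<close>

lemma ureach_imp_path:
  assumes "(u, v) \<in> ureach E"
  shows "\<exists>p. p \<noteq> [] \<and> hd p = u \<and> last p = v \<and> distinct p \<and> vlist_edges p \<subseteq> E"
  using assms unfolding ureach_def
proof (induction rule: converse_rtrancl_induct)
  case base
  then show ?case
    by (intro exI[of _ "[v]"]) simp
next
  case (step x y)
  then obtain p where p: "p \<noteq> []" "hd p = y" "last p = v" "distinct p" "vlist_edges p \<subseteq> E"
    by blast
  show ?case
  proof (cases "x \<in> set p")
    case True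
    then obtain q r where "p = q @ x # r"
      by (meson split_list)
    then have "last (x # r) = v \<and> distinct (x # r) \<and> vlist_edges (x # r) \<subseteq> E"
      using p vlist_edges_suffix[of "x # r" q] by auto
    then show ?thesis
      by (intro exI[of _ "x # r"]) simp
  next
    case False
    obtain q where q: "p = y # q"
      using p(1,2) by (cases p) auto
    have "distinct (x # p) \<and> vlist_edges (x # p) \<subseteq> E"
      using False p(4,5) step.hyps(1) unfolding q by (simp add: vlist_edges_Cons2)
    then show ?thesis
      using p(1,3) by (intro exI[of _ "x # p"]) simp
  qed
qed

text \<open>The condition \<open>u \<in> uverts G\<close> is there because \<open>ureach\<close>
  relates even a non-vertex to itself. On a path with at least two vertices, each vertex lies on an
  edge and is therefore in \<open>uverts G\<close>.\<close>

lemma upath_iff_ureach: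
  assumes "uedges G \<subseteq> all_uedges (uverts G)"
  shows "(\<exists>p. upath G u p v) \<longleftrightarrow> u \<in> uverts G \<and> (u, v) \<in> ureach (uedges G)"
proof
  assume "\<exists>p. upath G u p v"
  then obtain p where p: "upath G u p v"
    by blast
  then have "(u, v) \<in> ureach (uedges G)"
    using vlist_edges_ureach[of p] ureach_mono[of "vlist_edges p" "uedges G" u v]
    by (auto simp: upath_def)
  then show "u \<in> uverts G \<and> (u, v) \<in> ureach (uedges G)"
    using p hd_in_set[of p] by (auto simp: upath_def)
next
  assume u: "u \<in> uverts G \<and> (u, v) \<in> ureach (uedges G)"
  then obtain p where p: "p \<noteq> []" "hd p = u" "last p = v" "distinct p" "vlist_edges p \<subseteq> uedges G"
    using ureach_imp_path[of u v "uedges G"] by blast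
  have "set p \<subseteq> uverts G"
  proof
    fix w assume w: "w \<in> set p"
    show "w \<in> uverts G"
    proof (cases "length p \<ge> 2")
      case True
      then obtain e where "e \<in> vlist_edges p" "w \<in> e"
        using in_vlist_edge[OF w] by blast
      then show ?thesis
        using p(5) assms by (auto simp: all_uedges_def)
    next
      case False
      then have "p = [u]"
        using p(1,2) by (cases p rule: remdups_adj.cases) auto
      then show ?thesis
        using w u by simp
    qed
  qed
  then show "\<exists>p. upath G u p v"
    using p unfolding upath_def by blast
qed

lemma ucomponents_ureach:
  assumes "uedges G \<subseteq> all_uedges (uverts G)"
  shows "ucomponents G = (\<lambda>u. ureach (uedges G) `` {u}) ` uverts G"
proof -
  have "{v \<in> uverts G. \<exists>p. upath G u p v} = ureach (uedges G) `` {u}" if "u \<in> uverts G" for u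
    using that ureach_in_verts[OF _ assms] by (auto simp: upath_iff_ureach[OF assms])
  then show ?thesis
    unfolding ucomponents_def by auto
qed

text \<open>If the endpoints of an edge were still joined after its deletion, the joining path
  together with the edge would form a cycle.\<close>

lemma utree_uforest:
  assumes "utree T"
  shows "uforest (uedges T)"
  unfolding uforest_def
proof (intro allI impI notI)
  fix u v assume uv: "{u, v} \<in> uedges T" "(u, v) \<in> ureach (uedges T - {{u, v}})"
  have sub: "uedges T \<subseteq> all_uedges (uverts T)"
    using assms by (auto simp: utree_def simple_ugraph_def)
  then have "u \<noteq> v" "u \<in> uverts T"
    using uv(1) by (auto simp: all_uedges_def doubleton_eq_iff)
  let ?G = "UGraph (uverts T) (uedges T - {{u, v}})"
  obtain p where p: "upath ?G u p v"
    using upath_iff_ureach[of ?G u v] uv(2) sub \<open>u \<in> uverts T\<close> by auto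
  \<comment> \<open>The ends differ, and a path with just two vertices would use the deleted
    edge.\<close>
  have "length p \<ge> 3"
  proof (rule ccontr)
    assume "\<not> length p \<ge> 3"
    then have "p = [u, v]"
      using p \<open>u \<noteq> v\<close> unfolding upath_def
      by (auto simp: not_le numeral_3_eq_3 less_Suc_eq length_Suc_conv)
    then show False
      using p by (simp add: upath_def vlist_edges_Cons2)
  qed
  then have "ucycle T p"
    using p uv(1) by (auto simp: upath_def ucycle_def insert_commute)
  then show False
    using assms by (simp add: utree_def)
qed

lemma utree_ureach:
  assumes "utree T"
  shows "uverts T \<times> uverts T \<subseteq> ureach (uedges T)"
proof -
  have "uedges T \<subseteq> all_uedges (uverts T)"
    using assms by (auto simp: utree_def simple_ugraph_def)
  then show ?thesis
    using assms by (auto simp: utree_def uconnected_def upath_iff_ureach)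
qed

text \<open>If \<open>e\<close> is the first edge, distinctness keeps the rest of the path off
  \<open>e\<close>; a connection between the ends avoiding \<open>e\<close> would then also join the
  endpoints of \<open>e\<close>. If \<open>e\<close> comes later, the first edge survives and the
  claim for the tail carries over.\<close>

lemma uforest_path_edge_separates:
  assumes "uforest E" "distinct p" "vlist_edges p \<subseteq> E" "e \<in> vlist_edges p"
  shows "(hd p, last p) \<notin> ureach (E - {e})"
  using assms(2-)
proof (induction p rule: induct_list012)
  case (3 x y p)
  show ?case
  proof (cases "e = {x, y}")
    case True
    have "e \<notin> vlist_edges (y # p)"
      using vlist_edges_subset[of e "y # p"] 3(3) True by auto
    then have "vlist_edges (y # p) \<subseteq> E - {e}"
      using 3(4) by (auto simp: vlist_edges_Cons2)
    then have "(y, last (y # p)) \<in> ureach (E - {e})"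
      using vlist_edges_ureach[of "y # p"]
        ureach_mono[of "vlist_edges (y # p)" "E - {e}" y "last (y # p)"] by simp
    moreover have "(x, y) \<notin> ureach (E - {e})"
      using assms(1) 3(4) True by (auto simp: uforest_def vlist_edges_Cons2)
    ultimately show ?thesis
      using ureach_trans[OF _ ureach_sym, of x "last (y # p)" "E - {e}" y] by auto
  next
    case False
    then have "(y, last (y # p)) \<notin> ureach (E - {e})"
      using 3 by (auto simp: vlist_edges_Cons2)
    moreover have "(x, y) \<in> ureach (E - {e})"
      using 3(4) False by (intro ureach_edge) (auto simp: vlist_edges_Cons2)
    ultimately show ?thesis
      using ureach_trans[OF ureach_sym, of x y "E - {e}" "last (y # p)"] by auto
  qed
qed auto

lemma utree_path_edge_components:
  assumes "utree T" "upath T u p v" "e \<in> vlist_edges p"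
  shows "\<exists>A B. ucomponents (del_uedge T e) = {A, B} \<and> A \<noteq> B \<and> u \<in> A \<and> v \<in> B"
proof -
  let ?E = "uedges T" and ?V = "uverts T"
  let ?r = "ureach (?E - {e})"
  have sub: "?E \<subseteq> all_uedges ?V"
    using assms(1) by (auto simp: utree_def simple_ugraph_def)
  have e: "e \<in> ?E"
    using assms(2,3) by (auto simp: upath_def)
  then obtain a b where ab: "e = {a, b}" "a \<in> ?V"
    using sub by (auto simp: all_uedges_def)
  have uv: "u \<in> ?V" "v \<in> ?V"
    using assms(2) by (auto simp: upath_def)
  have nuv: "(u, v) \<notin> ?r"
    using uforest_path_edge_separates[OF utree_uforest[OF assms(1)]] assms(2,3)
    by (auto simp: upath_def)
  \<comment> \<open>Putting \<open>e\<close> back affects only the classes of \<open>a\<close> and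
    \<open>b\<close>; a vertex in neither would remain cut off from \<open>a\<close> in the whole
    tree.\<close>
  have cover: "(a, w) \<in> ?r \<or> (b, w) \<in> ?r" if "w \<in> ?V" for w
  proof (rule ccontr)
    assume n: "\<not> ?thesis"
    have "insert {a, b} (?E - {e}) = ?E"
      using e ab by auto
    moreover have "w \<notin> ?r `` {a, b}"
      using n by blast
    ultimately have "ureach ?E `` {w} = ?r `` {w}"
      using ureach_insert[of a b "?E - {e}" w] by simp
    moreover have "(w, a) \<in> ureach ?E"
      using utree_ureach[OF assms(1)] that ab(2) by auto
    ultimately show False
      using n ureach_sym[of w a] by blast
  qed
  have join: "(x, y) \<in> ?r" if "(c, x) \<in> ?r" "(c, y) \<in> ?r" for c x y
    using ureach_trans[OF ureach_sym[OF that(1)] that(2)] .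
  \<comment> \<open>At most two classes exist and \<open>u\<close>, \<open>v\<close> lie in
    different ones, so \<open>u\<close> and \<open>v\<close> can replace \<open>a\<close> and
    \<open>b\<close> as representatives.\<close>
  have two: "(u, w) \<in> ?r \<or> (v, w) \<in> ?r" if "w \<in> ?V" for w
    using cover[OF that] cover[OF uv(1)] cover[OF uv(2)] nuv
      join[of a u w] join[of a v w] join[of b u w] join[of b v w] join[of a u v] join[of b u v]
    by argo
  have "ucomponents (del_uedge T e) = (\<lambda>w. ?r `` {w}) ` ?V"
    using sub by (subst ucomponents_ureach) (auto simp: del_uedge_def)
  also have "\<dots> = {?r `` {u}, ?r `` {v}}"
  proof
    have "?r `` {w} \<in> {?r `` {u}, ?r `` {v}}" if "w \<in> ?V" for w
      using two[OF that] ureach_class_eq[of u w "uedges T - {e}"]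
        ureach_class_eq[of v w "uedges T - {e}"] by fast
    then show "(\<lambda>w. ?r `` {w}) ` ?V \<subseteq> {?r `` {u}, ?r `` {v}}"
      by (rule image_subsetI)
  qed (use uv in simp)
  finally have "ucomponents (del_uedge T e) = {?r `` {u}, ?r `` {v}}" .
  moreover have "u \<in> ?r `` {u}" "v \<in> ?r `` {v}" "v \<notin> ?r `` {u}"
    using nuv by simp_all
  ultimately show ?thesis
    by metis
qed

section \<open>Existence of maximum spanning trees\<close>

lemma finite_all_uedges: "finite V \<Longrightarrow> finite (all_uedges V)"
  by (rule finite_subset[of _ "Pow V"]) (auto simp: all_uedges_def)

text \<open>Any star is a spanning tree of the complete graph, which makes the set of competitors
  for the maximum nonempty.\<close>

lemma utree_star:
  assumes "finite V" "c \<in> V"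
  shows "utree (UGraph V {{c, v} | v. v \<in> V - {c}})" (is "utree ?T")
proof -
  have simple: "uedges ?T \<subseteq> all_uedges (uverts ?T)"
    using assms(2) by (auto simp: all_uedges_def)
  have star: "(c, v) \<in> ureach (uedges ?T)" if "v \<in> V" for v
  proof (cases "v = c")
    case False
    then show ?thesis
      using that by (intro ureach_edge) auto
  qed simp
  have "(u, v) \<in> ureach (uedges ?T)" if "u \<in> V" "v \<in> V" for u v
    using ureach_trans[OF ureach_sym[OF star[OF that(1)]] star[OF that(2)]] .
  then have "uconnected ?T"
    unfolding uconnected_def upath_iff_ureach[OF simple] by simp
  moreover have "\<not> ucycle ?T p" for p
  proof
    assume p: "ucycle ?T p"
    then obtain x y z q where q: "p = x # y # z # q"
      unfolding ucycle_def
      by (auto simp: numeral_3_eq_3 Suc_le_length_iff)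
    \<comment> \<open>Every edge contains the centre, but these three edges of a cycle have no
      common vertex.\<close>
    have "c \<in> {x, y}" "c \<in> {y, z}" "c \<in> {last p, x}"
      using p q by (auto simp: ucycle_def vlist_edges_Cons2 doubleton_eq_iff)
    moreover have "last p \<in> set (z # q)"
      using q by simp
    ultimately show False
      using p q by (auto simp: ucycle_def)
  qed
  ultimately show ?thesis
    using assms(1) simple by (simp add: utree_def simple_ugraph_def)
qed

lemma ex_spanning_tree_complete:
  assumes "finite V"
  shows "\<exists>T. uspanning_tree T (complete_ugraph V)"
proof (cases "V = {}")
  case True
  then have "uspanning_tree (UGraph {} {}) (complete_ugraph V)"
    by (auto simp: uspanning_tree_def complete_ugraph_def utree_def simple_ugraph_def
        uconnected_def ucycle_def)
  then show ?thesis ..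
next
  case False
  then obtain c where c: "c \<in> V"
    by blast
  then show ?thesis
    using utree_star[OF assms c]
    by (intro exI[of _ "UGraph V {{c, v} | v. v \<in> V - {c}}"])
      (auto simp: uspanning_tree_def complete_ugraph_def all_uedges_def)
qed

text \<open>A spanning tree is determined by a subset of the finitely many edges, so the weights
  form a finite nonempty set.\<close>

lemma ex_max_spanning_tree_complete:
  assumes "finite V"
  shows "\<exists>T. max_spanning_tree w T (complete_ugraph V)"
proof -
  let ?X = "{T. uspanning_tree T (complete_ugraph V)}"
  have "T \<in> UGraph V ` Pow (all_uedges V)" if "T \<in> ?X" for T
    using that by (cases T) (auto simp: uspanning_tree_def complete_ugraph_def)
  then have "finite ?X"
    using finite_all_uedges[OF assms] by (meson finite_Pow_iff finite_imageI finite_subset subsetI)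
  moreover have "?X \<noteq> {}"
    using ex_spanning_tree_complete[OF assms] by blast
  ultimately have M: "finite (total_weight w ` ?X)" "total_weight w ` ?X \<noteq> {}"
    by simp_all
  obtain T where T: "T \<in> ?X" "total_weight w T = Max (total_weight w ` ?X)"
    using Max_in[OF M] by (metis (no_types, lifting) imageE)
  have "total_weight w T' \<le> total_weight w T" if "T' \<in> ?X" for T'
    using Max_ge[OF M(1)] that unfolding T(2) by blast
  with T(1) show ?thesis
    by (auto simp: max_spanning_tree_def)
qed

section \<open>Junction trees and maximum spanning trees\<close>

lemma total_mid_weight:
  assumes "finite \<S>" "\<And>S. S \<in> \<S> \<Longrightarrow> finite S" "uedges T \<subseteq> all_uedges \<S>"
  shows "total_weight mid_weight T = (\<Sum>x \<in> \<Union>\<S>. card {e \<in> uedges T. x \<in> mid e})"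
proof -
  have fin: "finite (uedges T)" "finite (\<Union>\<S>)"
    using assms finite_all_uedges finite_subset by blast+
  \<comment> \<open>Edges are nonempty sets of members of \<open>\<S>\<close>, so the intersection
    \<open>mid e\<close> does not degenerate to \<open>UNIV\<close> and stays inside
    \<open>\<Union>\<S>\<close>.\<close>
  have "mid e = {x \<in> \<Union>\<S>. x \<in> mid e}" if "e \<in> uedges T" for e
    using that assms(3) by (auto simp: all_uedges_def mid_def)
  then have "total_weight mid_weight T = (\<Sum>e \<in> uedges T. card {x \<in> \<Union>\<S>. x \<in> mid e})"
    unfolding total_weight_def mid_weight_def by (metis (no_types, lifting) sum.cong)
  also have "\<dots> = (\<Sum>x \<in> \<Union>\<S>. card {e \<in> uedges T. x \<in> mid e})"
    using sum.swap_restrict[OF fin, of "\<lambda>_ _. 1::nat" "\<lambda>e x. x \<in> mid e"] by simp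
  finally show ?thesis .
qed

lemma junction_tree_cut:
  fixes \<S> :: "'a set set"
  assumes fin: "finite \<S>" "\<And>S. S \<in> \<S> \<Longrightarrow> finite S"
    and J: "junction_tree \<S> J"
    and T: "max_spanning_tree mid_weight T (intersection_graph \<S>)"
    and e: "e \<in> uedges T"
    and comps: "ucomponents (del_uedge T e) = {\<S>\<^sub>1, \<S>\<^sub>2}" "\<S>\<^sub>1 \<noteq> \<S>\<^sub>2"
  shows "\<Union>\<S>\<^sub>1 \<inter> \<Union>\<S>\<^sub>2 \<subseteq> mid e"
proof
  fix x assume x: "x \<in> \<Union>\<S>\<^sub>1 \<inter> \<Union>\<S>\<^sub>2"
  \<comment> \<open>\<open>V y\<close> and \<open>E G y\<close> are the vertices and edges of the
    subgraph of \<open>G\<close> induced by the sets containing \<open>y\<close>: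
    \<open>y \<in> mid e\<close> means that \<open>y\<close> lies in both endpoints of
    \<open>e\<close>.\<close>
  define V where "V y = {S \<in> \<S>. y \<in> S}" for y
  define E where "E G y = {e \<in> uedges G. y \<in> mid e}" for G :: "'a set ugraph" and y
  have tree: "utree J" "utree T" and verts: "uverts J = \<S>" "uverts T = \<S>"
    using J T by (auto simp: junction_tree_def max_spanning_tree_def uspanning_tree_def
        complete_ugraph_def)
  then have sub: "uedges J \<subseteq> all_uedges \<S>" "uedges T \<subseteq> all_uedges \<S>"
    by (auto simp: utree_def simple_ugraph_def)
  have V: "finite (V y)" "V y \<noteq> {}" if "y \<in> \<Union>\<S>" for y
    using fin that by (auto simp: V_def)
  have E: "finite (E G y)" "E G y \<subseteq> all_uedges (V y)" "uforest (E G y)"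
    if "utree G" "uverts G = \<S>" for G y
  proof -
    have G: "uedges G \<subseteq> all_uedges \<S>"
      using that by (auto simp: utree_def simple_ugraph_def)
    then show "finite (E G y)"
      unfolding E_def using fin(1) finite_all_uedges finite_subset by fastforce
    show "E G y \<subseteq> all_uedges (V y)"
    proof
      fix f assume f: "f \<in> E G y"
      then have "f \<in> all_uedges \<S>"
        using G by (auto simp: E_def)
      then obtain u v where "f = {u, v}" "u \<in> \<S>" "v \<in> \<S>" "u \<noteq> v"
        by (auto simp: all_uedges_def)
      then show "f \<in> all_uedges (V y)"
        using f by (auto simp: E_def V_def all_uedges_def mid_def)
    qed
    show "uforest (E G y)"
      using uforest_subset[OF utree_uforest[OF that(1)]] by (auto simp: E_def)
  qed
  \<comment> \<open>On the path in \<open>J\<close> between two sets containing \<open>y\<close>,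
    every edge has \<open>y\<close> in its middle set, so the induced forest is connected.\<close>
  have EJ: "Suc (card (E J y)) = card (V y)" if y: "y \<in> \<Union>\<S>" for y
  proof -
    have "(A, B) \<in> ureach (E J y)" if AB: "A \<in> V y" "B \<in> V y" for A B
    proof -
      have "A \<in> \<S>" "B \<in> \<S>"
        using AB by (auto simp: V_def)
      then obtain p where p: "upath J A p B"
        using tree(1) verts(1) unfolding utree_def uconnected_def by blast
      then have "\<forall>f \<in> vlist_edges p. A \<inter> B \<subseteq> mid f"
        using J \<open>A \<in> \<S>\<close> \<open>B \<in> \<S>\<close> by (auto simp: junction_tree_def)
      then have "vlist_edges p \<subseteq> E J y"
        using p AB by (auto simp: E_def V_def upath_def)
      moreover have "(A, B) \<in> ureach (vlist_edges p)"
        using p vlist_edges_ureach[of p] by (auto simp: upath_def)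
      ultimately show ?thesis
        by (rule ureach_mono)
    qed
    then show ?thesis
      using uforest_Suc_card_iff[OF E(1)[OF tree(1) verts(1)] V(1)[OF y]
          E(2,3)[OF tree(1) verts(1)] V(2)[OF y]] by auto
  qed
  have less: "card (E T y) < card (V y)" if "y \<in> \<Union>\<S>" for y
    by (rule uforest_card_less[OF E(1)[OF tree(2) verts(2)] V(1)[OF that]
          E(2,3)[OF tree(2) verts(2)] V(2)[OF that]])
  have le: "card (E T y) \<le> card (E J y)" if "y \<in> \<Union>\<S>" for y
    using less[OF that] EJ[OF that] by linarith
  have "total_weight mid_weight J \<le> total_weight mid_weight T"
    using T tree(1) verts(1) sub(1)
    by (auto simp: max_spanning_tree_def uspanning_tree_def complete_ugraph_def)
  then have "(\<Sum>y \<in> \<Union>\<S>. card (E J y)) \<le> (\<Sum>y \<in> \<Union>\<S>. card (E T y))"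
    using total_mid_weight[OF fin] sub by (simp add: E_def)
  \<comment> \<open>Maximality of \<open>T\<close> gives one inequality, the termwise bound
    \<open>le\<close> the other.\<close>
  then have sums: "(\<Sum>y \<in> \<Union>\<S>. card (E T y)) = (\<Sum>y \<in> \<Union>\<S>. card (E J y))"
    using sum_mono[OF le] by (rule order_antisym[rotated])
  have sub': "uedges T - {e} \<subseteq> all_uedges \<S>"
    using sub(2) by blast
  let ?r = "ureach (uedges T - {e})"
  have "uedges (del_uedge T e) = uedges T - {e}" "uverts (del_uedge T e) = \<S>"
    by (simp_all add: del_uedge_def verts(2))
  then have comps': "{\<S>\<^sub>1, \<S>\<^sub>2} = (\<lambda>u. ?r `` {u}) ` \<S>"
    using ucomponents_ureach[of "del_uedge T e"] sub' unfolding comps(1) by metis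
  have "\<S>\<^sub>1 \<in> (\<lambda>u. ?r `` {u}) ` \<S>" "\<S>\<^sub>2 \<in> (\<lambda>u. ?r `` {u}) ` \<S>"
    unfolding comps'[symmetric] by simp_all
  then obtain a b where ab: "a \<in> \<S>" "\<S>\<^sub>1 = ?r `` {a}" "b \<in> \<S>" "\<S>\<^sub>2 = ?r `` {b}"
    by (elim imageE)
  obtain A B where AB: "A \<in> \<S>\<^sub>1" "B \<in> \<S>\<^sub>2" "x \<in> A" "x \<in> B"
    using x by blast
  have ABS: "A \<in> \<S>" "B \<in> \<S>"
    using AB(1,2) ureach_in_verts[OF _ sub' ab(1)] ureach_in_verts[OF _ sub' ab(3)]
    unfolding ab by simp_all
  then have xS: "x \<in> \<Union>\<S>"
    using AB by blast
  \<comment> \<open>Termwise \<open>\<le>\<close> with equal finite sums forces equality in each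
    term, in particular at \<open>x\<close>.\<close>
  have "card (E T x) = card (E J x)"
    by (rule sum_mono_inv[OF sums _ xS]) (use le fin in auto)
  then have "V x \<times> V x \<subseteq> ureach (E T x)"
    using EJ[OF xS] uforest_Suc_card_iff[OF E(1)[OF tree(2) verts(2)] V(1)[OF xS]
        E(2,3)[OF tree(2) verts(2)] V(2)[OF xS]] by auto
  then have reach: "(A, B) \<in> ureach (E T x)"
    using AB ABS by (auto simp: V_def)
  \<comment> \<open>Otherwise deleting \<open>e\<close> leaves the connected forest on
    \<open>V x\<close> intact, so \<open>A\<close> and \<open>B\<close> would lie in one
    component.\<close>
  show "x \<in> mid e"
  proof (rule ccontr)
    assume "x \<notin> mid e"
    then have "E T x \<subseteq> uedges T - {e}"
      by (auto simp: E_def)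
    then have "(A, B) \<in> ?r"
      using reach by (rule ureach_mono)
    moreover have "(a, A) \<in> ?r" "(b, B) \<in> ?r"
      using AB(1,2) unfolding ab by simp_all
    ultimately have "\<S>\<^sub>1 = \<S>\<^sub>2"
      unfolding ab using ureach_class_eq[of a A] ureach_class_eq[of A B] ureach_class_eq[of b B]
      by simp
    then show False
      using comps(2) by simp
  qed
qed

text \<open>An edge on a path has the two ends on opposite sides, so their common elements fall
  under the cut condition. The claim for vertices follows from that for edges, as
  \<open>mid e\<close> is contained in each endpoint of \<open>e\<close>; a one-vertex path is
  trivial.\<close>

lemma cut_property_junction_tree:
  assumes tree: "utree T" "uverts T = \<S>"
    and cut: "\<And>e \<S>\<^sub>1 \<S>\<^sub>2. e \<in> uedges T \<Longrightarrow> ucomponents (del_uedge T e) = {\<S>\<^sub>1, \<S>\<^sub>2} \<Longrightarrow>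
      \<S>\<^sub>1 \<noteq> \<S>\<^sub>2 \<Longrightarrow> \<Union>\<S>\<^sub>1 \<inter> \<Union>\<S>\<^sub>2 \<subseteq> mid e"
  shows "junction_tree \<S> T"
proof -
  have edges: "S\<^sub>1 \<inter> S\<^sub>2 \<subseteq> mid e" if p: "upath T S\<^sub>1 p S\<^sub>2" and e: "e \<in> vlist_edges p" for S\<^sub>1 S\<^sub>2 p e
  proof -
    obtain A B where AB: "ucomponents (del_uedge T e) = {A, B}" "A \<noteq> B" "S\<^sub>1 \<in> A" "S\<^sub>2 \<in> B"
      using utree_path_edge_components[OF tree(1) p e] by blast
    have "e \<in> uedges T"
      using p e by (auto simp: upath_def)
    then show ?thesis
      using cut[OF _ AB(1,2)] AB(3,4) by blast
  qed
  have "S\<^sub>1 \<inter> S\<^sub>2 \<subseteq> S" if p: "upath T S\<^sub>1 p S\<^sub>2" and S: "S \<in> set p" for S\<^sub>1 S\<^sub>2 p S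
  proof (cases "length p \<ge> 2")
    case True
    then obtain e where e: "e \<in> vlist_edges p" "S \<in> e"
      using in_vlist_edge[OF S] by blast
    have "mid e \<subseteq> S"
      unfolding mid_def using e(2) by (rule Inter_lower)
    with edges[OF p e(1)] show ?thesis
      by (rule subset_trans)
  next
    case False
    then have "p = [S\<^sub>1]"
      using p by (cases p rule: remdups_adj.cases) (auto simp: upath_def)
    then show ?thesis
      using S by auto
  qed
  then show ?thesis
    using edges tree unfolding junction_tree_def by blast
qed

theorem theorem2:
  fixes \<S> :: "'a set set"
  assumes "finite \<S>" and "\<And>S. S \<in> \<S> \<Longrightarrow> finite S"
  shows "CDC_admits_junction_tree \<S> \<longleftrightarrow>
    (\<forall>T. max_spanning_tree mid_weight T (intersection_graph \<S>) \<longrightarrow>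
      (\<forall>e \<in> uedges T. \<forall>\<S>\<^sub>1 \<S>\<^sub>2.
        ucomponents (del_uedge T e) = {\<S>\<^sub>1, \<S>\<^sub>2} \<and> \<S>\<^sub>1 \<noteq> \<S>\<^sub>2 \<longrightarrow>
          \<Union> \<S>\<^sub>1 \<inter> \<Union> \<S>\<^sub>2 \<subseteq> mid e))"
    (is "?lhs \<longleftrightarrow> ?rhs")
proof
  assume ?lhs
  then obtain J where "junction_tree \<S> J"
    unfolding CDC_admits_junction_tree_def ..
  from junction_tree_cut[OF assms this] show ?rhs
    by simp
next
  assume cut: ?rhs
  \<comment> \<open>The right-hand side only speaks about maximum spanning trees, so one must exist
    to serve as the junction tree.\<close>
  obtain T where T: "max_spanning_tree mid_weight T (intersection_graph \<S>)"
    using ex_max_spanning_tree_complete[OF assms(1)] by blast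
  then have "utree T" "uverts T = \<S>"
    by (auto simp: max_spanning_tree_def uspanning_tree_def complete_ugraph_def)
  then have "junction_tree \<S> T"
    by (rule cut_property_junction_tree) (simp add: cut[rule_format, OF T])
  then show ?lhs
    unfolding CDC_admits_junction_tree_def by blast
qed

end
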